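(* Let $n>l$, where $l$ is the order of the linearly ordered semilattice $L_l$. The average number $\overline{\mathrm{Irr}}(n,l)$ of irreducible components of the solution sets over $L_l$ of equations from $Eq(n)$ equals \[ \overline{\mathrm{Irr}}(n,l)=\frac{3^n\genfrac{\{}{\}}{0pt}{}{n}{l}^{\ast}-2S(n,l)}{3^n-2}, \qquad\text{where}\qquad S(n,l)=\sum_{i=1}^{n-1}\binom{n}{i}\genfrac{\{}{\}}{0pt}{}{n-i}{l-1}^{\ast}3^{n-i}. \]
   Context: $L_l=\{a_1,\dots,a_l\}$ with $a_1<a_2<\dots<a_l$ is the linearly ordered semilattice of $l$ elements, with multiplication $a_i\cdot a_j=a_{\min(i,j)}$. A term in the variables $X=\{x_1,\dots,x_n\}$ is a (non-empty) commutative word in the letters $x_i$ (no constants); $\mathrm{Var}(t)$ is the set of variables occurring in $t$, and terms with the same set of variables are identified. An equation is an equality of terms $t(X)=s(X)$, regarded as an ordered pair of terms (so $t(X)=s(X)$ and $s(X)=t(X)$ are different equations when $\mathrm{Var}(t)\neq\mathrm{Var}(s)$). $Eq(n)$ is the set of equations $t(X)=s(X)$ such that every variable $x_1,\dots,x_n$ occurs in $t$ or in $s$; thus an element of $Eq(n)$ is determined by an ordered pair $(\mathrm{Var}(t),\mathrm{Var}(s))$ of non-empty subsets of $X$ with union $X$, and $\#Eq(n)=3^n-2$. A point $P\in L_l^n$ is a solution of $t(X)=s(X)$ if $t(P)=s(P)$ in $L_l$. A system is an arbitrary set of equations, and $\mathrm{V}(\mathbf{S})\subseteq L_l^n$ is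 the set of common solutions of a system $\mathbf{S}$ in $n$ variables. A set is algebraic over $L_l$ if it equals $\mathrm{V}(\mathbf S)$ for some system $\mathbf S$ in $n$ variables. An algebraic set is irreducible if it is not a proper finite union of other algebraic sets. The irreducible components of an algebraic set $Y$ are the sets in its decomposition (unique up to permutation) $Y=Y_1\cup\dots\cup Y_m$ into irreducible algebraic sets with $Y_i\nsubseteq Y_j$ for $i\neq j$. $\overline{\mathrm{Irr}}(n,l)$ is the sum over all equations in $Eq(n)$ of the number of irreducible components of the solution set in $L_l^n$, divided by $\#Eq(n)$. $\genfrac{\{}{\}}{0pt}{}{n}{m}$ denotes the Stirling number of the second kind (the number of partitions of an $n$-element set into $m$ non-empty unlabelled subsets), and $\genfrac{\{}{\}}{0pt}{}{n}{m}^{\ast}=m!\genfrac{\{}{\}}{0pt}{}{n}{m}$.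
   Formalization: The case l = 1 is excluded (l ≥ 2 is assumed): there L_1^n is one point, so the average is 1, while the printed formula gives 3^n/(3^n−2) because S(n,1) = 0. *)

theory Defs
  imports Complex_Main "HOL-Library.FuncSet" "HOL-Combinatorics.Stirling"
begin

(* The linearly ordered semilattice L_l is modelled on the carrier {1..l} (a_i is the number i)
   with multiplication min; the variable x_i is the index i, and a point of L_l^n is an extensional
   function on {1..n}. *)

definition chain :: "nat \<Rightarrow> nat set" where
  "chain l = {1..l}"

definition points :: "nat \<Rightarrow> nat \<Rightarrow> (nat \<Rightarrow> nat) set" where
  "points n l = ({1..n} \<rightarrow>\<^sub>E chain l)"

(* Terms with the same set of variables are identified, so a term is its set Var(t). *)

type_synonym trm = "nat set"
type_synonym equation = "trm \<times> trm"

definition terms :: "nat \<Rightarrow> trm set" where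
  "terms n = {t. t \<noteq> {} \<and> t \<subseteq> {1..n}}"

definition equations :: "nat \<Rightarrow> equation set" where
  "equations n = terms n \<times> terms n"

definition Eq :: "nat \<Rightarrow> equation set" where
  "Eq n = {(t, s) \<in> equations n. t \<union> s = {1..n}}"

(* Min is the iterated product of the semilattice operation min over a non-empty finite set;
   the lemma below expresses it through words. *)

definition term_value :: "trm \<Rightarrow> (nat \<Rightarrow> nat) \<Rightarrow> nat" where
  "term_value t P = Min (P ` t)"

lemma term_value_word:
  "term_value (set (x # xs)) P = fold min (map P xs) (P x)"
  unfolding term_value_def using Min.set_eq_fold[of "P x" "map P xs"] by simp

definition is_solution :: "equation \<Rightarrow> (nat \<Rightarrow> nat) \<Rightarrow> bool" where
  "is_solution e P \<longleftrightarrow> term_value (fst e) P = term_value (snd e) P"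

definition V :: "nat \<Rightarrow> nat \<Rightarrow> equation set \<Rightarrow> (nat \<Rightarrow> nat) set" where
  "V n l S = {P \<in> points n l. \<forall>e\<in>S. is_solution e P}"

definition algebraic :: "nat \<Rightarrow> nat \<Rightarrow> (nat \<Rightarrow> nat) set \<Rightarrow> bool" where
  "algebraic n l Y \<longleftrightarrow> (\<exists>S. S \<subseteq> equations n \<and> Y = V n l S)"

definition irreducible_algebraic :: "nat \<Rightarrow> nat \<Rightarrow> (nat \<Rightarrow> nat) set \<Rightarrow> bool" where
  "irreducible_algebraic n l Y \<longleftrightarrow> algebraic n l Y \<and>
     \<not> (\<exists>F. finite F \<and> (\<forall>Z\<in>F. algebraic n l Z \<and> Z \<noteq> Y) \<and> Y = \<Union>F)"

definition irreducible_decomposition ::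
    "nat \<Rightarrow> nat \<Rightarrow> (nat \<Rightarrow> nat) set \<Rightarrow> (nat \<Rightarrow> nat) set set \<Rightarrow> bool" where
  "irreducible_decomposition n l Y C \<longleftrightarrow>
     finite C \<and> (\<forall>Z\<in>C. irreducible_algebraic n l Z) \<and> Y = \<Union>C \<and>
     (\<forall>Z\<in>C. \<forall>W\<in>C. Z \<noteq> W \<longrightarrow> \<not> Z \<subseteq> W)"

definition irreducible_components ::
    "nat \<Rightarrow> nat \<Rightarrow> (nat \<Rightarrow> nat) set \<Rightarrow> (nat \<Rightarrow> nat) set set" where
  "irreducible_components n l Y = (THE C. irreducible_decomposition n l Y C)"

definition Irr_avg :: "nat \<Rightarrow> nat \<Rightarrow> real" where
  "Irr_avg n l =
     (\<Sum>e\<in>Eq n. real (card (irreducible_components n l (V n l {e})))) / real (card (Eq n))"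

definition ordered_Stirling :: "nat \<Rightarrow> nat \<Rightarrow> nat" where
  "ordered_Stirling n m = fact m * Stirling n m"

(* l - 1 is truncated; the intended range is l >= 2.  For l = 1 the term i = n, which would be
   ordered_Stirling 0 0 = 1, is not in the sum, and the averaging formula fails. *)

definition S_sum :: "nat \<Rightarrow> nat \<Rightarrow> nat" where
  "S_sum n l = (\<Sum>i = 1..n - 1. (n choose i) * ordered_Stirling (n - i) (l - 1) * 3 ^ (n - i))"

end

theory Submission
  imports Defs
begin

text \<open>The smallest algebraic set containing a point \<open>P\<close> consists of the points \<open>Q\<close> that are weakly
  monotone in \<open>P\<close> (\<open>P i \<le> P j\<close> implies \<open>Q i \<le> Q j\<close>), and these closures are exactly the irreducible
  algebraic sets. So the components of the solution set of an equation correspond to the maximal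
  closures, that is, to the finest solutions. Since \<open>n > l\<close>, every solution with fewer than \<open>l\<close>
  values can be refined, hence the finest solutions are the surjective ones. A surjection \<open>P\<close> solves
  \<open>t = s\<close> iff its lowest class \<open>B\<close> meets both \<open>t\<close> and \<open>s\<close>; there are
  \<open>3 ^ n - 2 * 3 ^ (n - card B)\<close> such equations, and summing over \<open>P\<close> gives the formula.\<close>

section \<open>Surjections and ordered Stirling numbers\<close>

definition surjections :: "'a set \<Rightarrow> 'b set \<Rightarrow> ('a \<Rightarrow> 'b) set" where
  "surjections A B = {f \<in> A \<rightarrow>\<^sub>E B. f ` A = B}"

lemma surjections_altdef: "surjections A B = {f \<in> extensional A. f ` A = B}"
  by (auto simp: surjections_def PiE_def)

lemma finite_surjections: "finite A \<Longrightarrow> finite B \<Longrightarrow> finite (surjections A B)"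
  unfolding surjections_def by (simp add: finite_PiE)

lemma ordered_Stirling_Suc_Suc:
  "ordered_Stirling (Suc n) (Suc m) =
     Suc m * (ordered_Stirling n (Suc m) + ordered_Stirling n m)"
  by (simp add: ordered_Stirling_def algebra_simps)

text \<open>Forgetting the value at \<open>a\<close> leaves a map on \<open>A\<close> that still
  covers \<open>B - {b}\<close>. Its image is \<open>B\<close> or \<open>B - {b}\<close>, according
  to whether \<open>b\<close> is also taken elsewhere; these two cases become the two summands of
  the Stirling recurrence.\<close>

lemma surjections_insert_value:
  assumes "a \<notin> A" "b \<in> B"
  shows "bij_betw (\<lambda>g. g(a := b)) (surjections A B \<union> surjections A (B - {b}))
           {f \<in> surjections (insert a A) B. f a = b}"
proof (rule bij_betw_byWitness[where f' = "\<lambda>f. f(a := undefined)"])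
  show "\<forall>g\<in>surjections A B \<union> surjections A (B - {b}). (g(a := b))(a := undefined) = g"
    using assms by (auto simp: surjections_altdef extensional_def fun_eq_iff)
  show "\<forall>f\<in>{f \<in> surjections (insert a A) B. f a = b}. (f(a := undefined))(a := b) = f"
    by auto
  have upd: "g(a := c) ` A = g ` A" for g :: "'a \<Rightarrow> 'b" and c
    using assms(1) by (intro image_cong) auto
  show "(\<lambda>g. g(a := b)) ` (surjections A B \<union> surjections A (B - {b}))
      \<subseteq> {f \<in> surjections (insert a A) B. f a = b}"
  proof clarify
    fix g assume g: "g \<in> surjections A B \<union> surjections A (B - {b})"
    then have "insert b (g ` A) = B" using assms(2) unfolding surjections_altdef by blast
    moreover have "g(a := b) \<in> extensional (insert a A)"
      using g by (auto simp: surjections_altdef extensional_def)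
    ultimately show "g(a := b) \<in> surjections (insert a A) B \<and> (g(a := b)) a = b"
      by (simp only: surjections_altdef image_insert upd fun_upd_same mem_Collect_eq)
  qed
  show "(\<lambda>f. f(a := undefined)) ` {f \<in> surjections (insert a A) B. f a = b}
      \<subseteq> surjections A B \<union> surjections A (B - {b})"
  proof (rule image_subsetI)
    fix f assume f: "f \<in> {f \<in> surjections (insert a A) B. f a = b}"
    have "insert b (f ` A) = B" using f by (auto simp: surjections_altdef)
    then have "f ` A = B \<or> f ` A = B - {b}" by blast
    moreover have "f(a := undefined) \<in> extensional A"
      using f by (auto simp: surjections_altdef extensional_def)
    ultimately show "f(a := undefined) \<in> surjections A B \<union> surjections A (B - {b})"
      by (simp only: surjections_altdef upd mem_Collect_eq Un_iff simp_thms)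
  qed
qed

text \<open>Surjections on \<open>insert a A\<close> are sorted by their value at \<open>a\<close>.
  All fibres have the same size by \<open>surjections_insert_value\<close>, which reproduces
  \<open>ordered_Stirling_Suc_Suc\<close>.\<close>

lemma card_surjections:
  assumes "finite A" "finite B"
  shows "card (surjections A B) = ordered_Stirling (card A) (card B)"
  using assms
proof (induction A arbitrary: B rule: finite_induct)
  case empty
  show ?case
    by (cases "B = {}") (auto simp: surjections_def ordered_Stirling_def card_gt_0_iff empty
        gr0_conv_Suc[of "card B"] dest!: gr0_implies_Suc)
next
  case (insert a A)
  show ?case
  proof (cases "B = {}")
    case True
    then show ?thesis using insert by (simp add: surjections_def ordered_Stirling_def)
  next
    case False
    then obtain m where m: "card B = Suc m"
      using insert.prems by (metis card_eq_0_iff not0_implies_Suc)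
    have fibre: "card {f \<in> surjections (insert a A) B. f a = b} =
        ordered_Stirling (card A) (Suc m) + ordered_Stirling (card A) m" if "b \<in> B" for b
    proof -
      have "card {f \<in> surjections (insert a A) B. f a = b} =
          card (surjections A B \<union> surjections A (B - {b}))"
        using bij_betw_same_card[OF surjections_insert_value[OF insert.hyps(2) that]] by simp
      \<comment> \<open>The two families are disjoint because their members have different
        images.\<close>
      also have "\<dots> = card (surjections A B) + card (surjections A (B - {b}))"
        using that insert by (intro card_Un_disjoint finite_surjections) (auto simp: surjections_def)
      finally show ?thesis using insert that m by simp
    qed
    have "surjections (insert a A) B = (\<Union>b\<in>B. {f \<in> surjections (insert a A) B. f a = b})"
      by (auto simp: surjections_def)
    then have "card (surjections (insert a A) B) =
        (\<Sum>b\<in>B. card {f \<in> surjections (insert a A) B. f a = b})"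
      using insert by (subst card_UN_disjoint[symmetric]) (auto simp: finite_surjections)
    then show ?thesis
      using fibre m insert by (simp add: ordered_Stirling_Suc_Suc)
  qed
qed

section \<open>Counting pairs of sets with a prescribed union\<close>

text \<open>Each element of \<open>A\<close> chooses independently among three places, coded by 0
  (only in \<open>s\<close>), 1 (only in \<open>t\<close>) and 2 (in both).\<close>

lemma card_covering_pairs:
  assumes "finite A"
  shows "card {(t, s). t \<union> s = A} = 3 ^ card A"
proof -
  have bij: "bij_betw (\<lambda>f. ({i \<in> A. f i \<noteq> 0}, {i \<in> A. f i \<noteq> 1})) (A \<rightarrow>\<^sub>E {0, 1, 2::nat})
      {(t, s). t \<union> s = A}"
  proof (rule bij_betw_byWitness
      [where f' = "\<lambda>(t, s). \<lambda>i\<in>A. if i \<notin> t then 0 else if i \<notin> s then 1 else 2"])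
    show "\<forall>f\<in>A \<rightarrow>\<^sub>E {0, 1, 2}.
        (case ({i \<in> A. f i \<noteq> 0}, {i \<in> A. f i \<noteq> 1}) of
          (t, s) \<Rightarrow> \<lambda>i\<in>A. if i \<notin> t then 0 else if i \<notin> s then 1 else 2) = f"
      by (auto simp: fun_eq_iff PiE_iff extensional_def)
  qed (auto simp: PiE_iff split: if_splits)
  have "card {0, 1, 2::nat} = 3" by simp
  then show ?thesis
    unfolding bij_betw_same_card[OF bij, symmetric] card_funcsetE[OF assms] by (rule arg_cong)
qed

text \<open>If \<open>t\<close> misses \<open>B\<close>, then \<open>s\<close> must contain all of
  \<open>B\<close>, so only the elements of \<open>A - B\<close> retain their three choices.
  Swapping the sides gives the second count.\<close>

lemma card_covering_pairs_avoiding: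
  assumes "finite A" "B \<subseteq> A"
  shows "card {(t, s). t \<union> s = A \<and> t \<inter> B = {}} = 3 ^ (card A - card B)"
    and "card {(t, s). t \<union> s = A \<and> s \<inter> B = {}} = 3 ^ (card A - card B)"
proof -
  have c: "card {(t, s). t \<union> s = A - B} = 3 ^ (card A - card B)"
    using assms card_covering_pairs[of "A - B"] by (simp add: card_Diff_subset finite_subset)
  have bij: "bij_betw (\<lambda>(t, s). (t, s \<union> B)) {(t, s). t \<union> s = A - B}
      {(t, s). t \<union> s = A \<and> t \<inter> B = {}}"
    by (rule bij_betw_byWitness[where f' = "\<lambda>(t, s). (t, s - B)"]) (use assms(2) in auto)
  show 1: "card {(t, s). t \<union> s = A \<and> t \<inter> B = {}} = 3 ^ (card A - card B)"
    unfolding bij_betw_same_card[OF bij, symmetric] by (rule c)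
  have bij': "bij_betw prod.swap {(t, s). t \<union> s = A \<and> t \<inter> B = {}} {(t, s). t \<union> s = A \<and> s \<inter> B = {}}"
    by (rule bij_betw_byWitness[where f' = prod.swap]) auto
  show "card {(t, s). t \<union> s = A \<and> s \<inter> B = {}} = 3 ^ (card A - card B)"
    unfolding bij_betw_same_card[OF bij', symmetric] by (rule 1)
qed

text \<open>The pairs not counted have a side that misses \<open>B\<close>. Both sides cannot miss
  it, since \<open>B\<close> is non-empty and covered, so the two bad families are disjoint. The
  additive form avoids truncated subtraction on \<open>nat\<close>.\<close>

lemma card_covering_pairs_meeting:
  assumes "finite A" "B \<subseteq> A" "B \<noteq> {}"
  shows "card {(t, s). t \<union> s = A \<and> t \<inter> B \<noteq> {} \<and> s \<inter> B \<noteq> {}} + 2 * 3 ^ (card A - card B)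
    = 3 ^ card A"
proof -
  let ?M = "{(t, s). t \<union> s = A \<and> t \<inter> B \<noteq> {} \<and> s \<inter> B \<noteq> {}}"
  let ?T = "{(t, s). t \<union> s = A \<and> t \<inter> B = {}}"
  let ?S = "{(t, s). t \<union> s = A \<and> s \<inter> B = {}}"
  have fin: "finite {(t, s). t \<union> s = A}"
    by (rule finite_subset[of _ "Pow A \<times> Pow A"]) (use assms(1) in auto)
  have "finite ?M" "finite ?T" "finite ?S" by (rule finite_subset[OF _ fin]; auto)+
  moreover have "?M \<inter> (?T \<union> ?S) = {}" "?T \<inter> ?S = {}" using assms(2,3) by auto
  ultimately have "card (?M \<union> (?T \<union> ?S)) = card ?M + (card ?T + card ?S)"
    by (simp add: card_Un_disjoint)
  moreover have "{(t, s). t \<union> s = A} = ?M \<union> (?T \<union> ?S)" by blast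
  ultimately have "card {(t, s). t \<union> s = A} = card ?M + (card ?T + card ?S)"
    by (simp only:)
  then show ?thesis
    unfolding card_covering_pairs[OF assms(1)] card_covering_pairs_avoiding[OF assms(1,2)]
    by linarith
qed

lemma Eq_altdef: "Eq n = {(t, s). t \<union> s = {1..n} \<and> t \<noteq> {} \<and> s \<noteq> {}}"
  unfolding Eq_def equations_def terms_def by blast

lemma finite_Eq: "finite (Eq n)"
  by (rule finite_subset[of _ "Pow {1..n} \<times> Pow {1..n}"]) (auto simp: Eq_altdef)

text \<open>This is \<open>card_covering_pairs_meeting\<close> with \<open>B\<close> the whole
  variable set: meeting it means being non-empty.\<close>

lemma card_Eq:
  assumes "0 < n"
  shows "card (Eq n) + 2 = 3 ^ n"
proof -
  define X where "X = {1..n}"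
  have X: "finite X" "X \<noteq> {}" "card X = n" using assms by (simp_all add: X_def)
  have "Eq n = {(t, s). t \<union> s = X \<and> t \<inter> X \<noteq> {} \<and> s \<inter> X \<noteq> {}}"
    unfolding Eq_altdef X_def by blast
  moreover have "card {(t, s). t \<union> s = X \<and> t \<inter> X \<noteq> {} \<and> s \<inter> X \<noteq> {}} + 2 = 3 ^ n"
    using card_covering_pairs_meeting[OF X(1) subset_refl X(2)] unfolding X(3) diff_self_eq_0
    by (simp only: power_0 mult_1_right)
  ultimately show ?thesis by (simp only:)
qed

section \<open>Solutions and monotone changes of a point\<close>

lemma term_value_eq:
  assumes "finite t" "i \<in> t" "\<forall>j\<in>t. P i \<le> P j"
  shows "term_value t P = P i"
  unfolding term_value_def by (rule Min_eqI) (use assms in auto)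

lemma obtain_minimizer:
  fixes P :: "'a \<Rightarrow> nat"
  assumes "finite t" "t \<noteq> {}"
  obtains i where "i \<in> t" "\<forall>j\<in>t. P i \<le> P j"
proof -
  have "Min (P ` t) \<in> P ` t" using assms by simp
  then obtain i where "i \<in> t" "P i = Min (P ` t)" by auto
  then show thesis using that assms by simp
qed

lemma finite_equation_sides:
  assumes "(t, s) \<in> equations n"
  shows "finite t" "finite s" "t \<noteq> {}" "s \<noteq> {}" "t \<subseteq> {1..n}" "s \<subseteq> {1..n}"
  using assms finite_subset[of _ "{1..n}"] by (auto simp: equations_def terms_def)

text \<open>A variable that minimizes \<open>P\<close> on one side of the equation also minimizes
  \<open>Q\<close> there. The two minimizers have equal \<open>P\<close>-values, and monotonicity in
  both directions makes their \<open>Q\<close>-values equal.\<close>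

lemma is_solution_mono:
  assumes e: "e \<in> equations n" and sol: "is_solution e P"
    and mono: "\<forall>i\<in>{1..n}. \<forall>j\<in>{1..n}. P i \<le> P j \<longrightarrow> Q i \<le> Q j"
  shows "is_solution e Q"
proof -
  obtain t s where ts: "e = (t, s)" by (cases e)
  note side = finite_equation_sides[OF e[unfolded ts]]
  obtain i where i: "i \<in> t" "\<forall>j\<in>t. P i \<le> P j" using obtain_minimizer side by metis
  obtain j where j: "j \<in> s" "\<forall>k\<in>s. P j \<le> P k" using obtain_minimizer side by metis
  have "P i = P j"
    using sol term_value_eq[OF side(1) i] term_value_eq[OF side(2) j]
    by (simp add: ts is_solution_def)
  moreover have "i \<in> {1..n}" "j \<in> {1..n}" using i j side by auto
  ultimately have "Q i = Q j" using mono by (simp add: order_antisym)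
  moreover have "term_value t Q = Q i"
    by (rule term_value_eq) (use side i mono in blast)+
  moreover have "term_value s Q = Q j"
    by (rule term_value_eq) (use side j mono in blast)+
  ultimately show ?thesis by (simp add: ts is_solution_def)
qed

section \<open>Closures of points, irreducible sets and uniqueness of decompositions\<close>

definition point_closure :: "nat \<Rightarrow> nat \<Rightarrow> (nat \<Rightarrow> nat) \<Rightarrow> (nat \<Rightarrow> nat) set" where
  "point_closure n l P =
     {Q \<in> points n l. \<forall>i\<in>{1..n}. \<forall>j\<in>{1..n}. P i \<le> P j \<longrightarrow> Q i \<le> Q j}"

lemma self_in_point_closure: "P \<in> points n l \<Longrightarrow> P \<in> point_closure n l P"
  by (simp add: point_closure_def)

lemma finite_points: "finite (points n l)"
  by (simp add: points_def chain_def finite_PiE)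

lemma algebraic_subset_points: "algebraic n l Y \<Longrightarrow> Y \<subseteq> points n l"
  by (auto simp: algebraic_def V_def)

lemma point_closure_subset_algebraic:
  assumes "algebraic n l Y" "P \<in> Y"
  shows "point_closure n l P \<subseteq> Y"
proof
  obtain S where S: "S \<subseteq> equations n" "Y = V n l S"
    using assms(1) by (auto simp: algebraic_def)
  fix Q assume Q: "Q \<in> point_closure n l P"
  have "is_solution e Q" if "e \<in> S" for e
  proof (rule is_solution_mono)
    show "e \<in> equations n" using that S by blast
    show "is_solution e P" using that assms(2) S(2) by (simp add: V_def)
  qed (use Q in \<open>simp add: point_closure_def\<close>)
  then show "Q \<in> Y" using Q S(2) by (simp add: V_def point_closure_def)
qed

text \<open>The inequality \<open>P i \<le> P j\<close> is the equation \<open>x\<^sub>i = x\<^sub>i x\<^sub>j\<close>.\<close>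

lemma algebraic_point_closure: "algebraic n l (point_closure n l P)"
proof -
  let ?E = "{({i}, {i, j}) | i j. i \<in> {1..n} \<and> j \<in> {1..n} \<and> P i \<le> P j}"
  have *: "is_solution ({i}, {i, j}) Q \<longleftrightarrow> Q i \<le> Q j" for i j Q
    by (simp add: is_solution_def term_value_def min_def)
  have "?E \<subseteq> equations n" by (auto simp: equations_def terms_def)
  moreover have "(\<forall>e\<in>?E. is_solution e Q) \<longleftrightarrow>
      (\<forall>i\<in>{1..n}. \<forall>j\<in>{1..n}. P i \<le> P j \<longrightarrow> Q i \<le> Q j)" for Q
  proof -
    have "(\<forall>e\<in>?E. is_solution e Q) \<longleftrightarrow>
        (\<forall>i\<in>{1..n}. \<forall>j\<in>{1..n}. P i \<le> P j \<longrightarrow> is_solution ({i}, {i, j}) Q)"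
      by blast
    then show ?thesis unfolding * .
  qed
  then have "point_closure n l P = V n l ?E"
    by (simp only: point_closure_def V_def)
  ultimately show ?thesis unfolding algebraic_def by blast
qed

text \<open>In a finite union of algebraic sets equal to the closure, the member containing
  \<open>P\<close> already contains the whole closure, so it is not a different set.\<close>

lemma irreducible_point_closure:
  assumes "P \<in> points n l"
  shows "irreducible_algebraic n l (point_closure n l P)"
  unfolding irreducible_algebraic_def
proof (intro conjI notI algebraic_point_closure; elim exE conjE)
  fix F assume F: "\<forall>Z\<in>F. algebraic n l Z \<and> Z \<noteq> point_closure n l P"
    and eq: "point_closure n l P = \<Union>F"
  have "P \<in> \<Union>F" unfolding eq[symmetric] by (rule self_in_point_closure[OF assms])
  then obtain Z where Z: "Z \<in> F" "P \<in> Z" by blast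
  then have "point_closure n l P \<subseteq> Z" using F by (intro point_closure_subset_algebraic) auto
  moreover have "Z \<subseteq> point_closure n l P" unfolding eq using Z by blast
  ultimately have "Z = point_closure n l P" by (rule subset_antisym[rotated])
  then show False using F Z by blast
qed

text \<open>An algebraic set is the finite union of the closures of its points, so irreducibility
  forces one of these closures to be the whole set.\<close>

lemma irreducible_imp_point_closure:
  assumes "irreducible_algebraic n l Y"
  shows "\<exists>P\<in>Y. Y = point_closure n l P"
proof (rule ccontr)
  assume no: "\<not> (\<exists>P\<in>Y. Y = point_closure n l P)"
  have alg: "algebraic n l Y" using assms by (simp add: irreducible_algebraic_def)
  let ?F = "point_closure n l ` Y"
  have Y: "Y \<subseteq> points n l" using algebraic_subset_points alg .
  have "finite ?F" using finite_subset[OF Y finite_points] by simp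
  moreover have "\<forall>Z\<in>?F. algebraic n l Z \<and> Z \<noteq> Y"
    using no algebraic_point_closure by blast
  moreover have "Y = \<Union>?F"
  proof
    show "Y \<subseteq> \<Union>?F" using Y by (auto intro!: self_in_point_closure)
    show "\<Union>?F \<subseteq> Y" by (rule UN_least) (rule point_closure_subset_algebraic[OF alg])
  qed
  ultimately have "\<exists>F. finite F \<and> (\<forall>Z\<in>F. algebraic n l Z \<and> Z \<noteq> Y) \<and> Y = \<Union>F"
    by (intro exI[of _ ?F] conjI)
  then show False using assms by (simp only: irreducible_algebraic_def simp_thms)
qed

text \<open>A member of one decomposition is the closure of a point, so it lies inside any member of
  the other that contains this point. Going there and back gives
  \<open>Z \<subseteq> W \<subseteq> Z'\<close> with \<open>Z\<close> and \<open>Z'\<close> in the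
  same decomposition, where inclusions between different members are excluded. By symmetry
  decompositions are unique, which justifies the definite description of the components.\<close>

lemma irreducible_decomposition_subset:
  assumes C: "irreducible_decomposition n l Y C" and D: "irreducible_decomposition n l Y D"
  shows "C \<subseteq> D"
proof
  have up: "\<exists>W\<in>E'. Z \<subseteq> W"
    if E: "irreducible_decomposition n l Y E" "irreducible_decomposition n l Y E'" "Z \<in> E"
    for E E' Z
  proof -
    have "irreducible_algebraic n l Z" using E by (simp add: irreducible_decomposition_def)
    then obtain P where P: "P \<in> Z" "Z = point_closure n l P"
      using irreducible_imp_point_closure by blast
    then obtain W where "W \<in> E'" "P \<in> W"
      using E unfolding irreducible_decomposition_def by blast
    moreover from this have "algebraic n l W"
      using E by (simp add: irreducible_decomposition_def irreducible_algebraic_def)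
    ultimately show ?thesis using P point_closure_subset_algebraic by blast
  qed
  fix Z assume Z: "Z \<in> C"
  obtain W where W: "W \<in> D" "Z \<subseteq> W" using up[OF C D Z] by blast
  obtain Z' where Z': "Z' \<in> C" "W \<subseteq> Z'" using up[OF D C W(1)] by blast
  have "Z = Z'" using C Z Z' W unfolding irreducible_decomposition_def by blast
  then show "Z \<in> D" using W Z' by auto
qed

lemma irreducible_components_eqI:
  assumes "irreducible_decomposition n l Y C"
  shows "irreducible_components n l Y = C"
  unfolding irreducible_components_def
proof (rule the_equality[where P = "irreducible_decomposition n l Y", OF assms])
  show "D = C" if "irreducible_decomposition n l Y D" for D
    using irreducible_decomposition_subset[OF assms that] irreducible_decomposition_subset[OF that assms]
    by (rule subset_antisym[rotated])
qed

section \<open>Finest solutions of a single equation\<close>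

text \<open>Since \<open>t\<close> and \<open>s\<close> together contain every variable, a common
  value of the two sides is the global minimum of \<open>P\<close>, and it is attained on both
  sides.\<close>

lemma Eq_solution_iff:
  assumes "(t, s) \<in> Eq n"
  shows "is_solution (t, s) P \<longleftrightarrow> (\<exists>i\<in>t. \<exists>j\<in>s. \<forall>k\<in>{1..n}. P i \<le> P k \<and> P j \<le> P k)"
proof
  have eqn: "(t, s) \<in> equations n" and cover: "t \<union> s = {1..n}" using assms by (auto simp: Eq_def)
  note side = finite_equation_sides[OF eqn]
  {
    assume sol: "is_solution (t, s) P"
    obtain i where i: "i \<in> t" "\<forall>j\<in>t. P i \<le> P j" using obtain_minimizer side by metis
    obtain j where j: "j \<in> s" "\<forall>k\<in>s. P j \<le> P k" using obtain_minimizer side by metis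
    have "P i = P j"
      using sol term_value_eq[OF side(1) i] term_value_eq[OF side(2) j]
      by (simp add: is_solution_def)
    then have "P i \<le> P k \<and> P j \<le> P k" if "k \<in> {1..n}" for k
      using that i j unfolding cover[symmetric] by auto
    then show "\<exists>i\<in>t. \<exists>j\<in>s. \<forall>k\<in>{1..n}. P i \<le> P k \<and> P j \<le> P k"
      using i(1) j(1) by blast
  }
  assume "\<exists>i\<in>t. \<exists>j\<in>s. \<forall>k\<in>{1..n}. P i \<le> P k \<and> P j \<le> P k"
  then obtain i j where ij: "i \<in> t" "j \<in> s" "\<forall>k\<in>{1..n}. P i \<le> P k \<and> P j \<le> P k" by blast
  have "term_value t P = P i" by (rule term_value_eq) (use ij side in auto)
  moreover have "term_value s P = P j" by (rule term_value_eq) (use ij side in auto)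
  moreover have "i \<in> {1..n}" "j \<in> {1..n}" using ij(1,2) side by blast+
  then have "P i = P j" using ij(3) by (simp add: order_antisym)
  ultimately show "is_solution (t, s) P" by (simp add: is_solution_def)
qed

text \<open>Every value is replaced by its rank among the attained values. This brings auxiliary
  points with values outside the chain back to an initial segment of it.\<close>

lemma order_isomorphic_ranking:
  fixes R :: "'a \<Rightarrow> nat"
  assumes "finite A"
  obtains P where "P \<in> A \<rightarrow>\<^sub>E {1..card (R ` A)}" "\<forall>i\<in>A. \<forall>j\<in>A. P i \<le> P j \<longleftrightarrow> R i \<le> R j"
    "card (P ` A) = card (R ` A)"
proof -
  define rank where "rank v = card {w \<in> R ` A. w \<le> v}" for v
  have less: "rank u < rank v" if "v \<in> R ` A" "u < v" for u v
    unfolding rank_def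
  proof (rule psubset_card_mono)
    have "v \<in> {w \<in> R ` A. w \<le> v}" "v \<notin> {w \<in> R ` A. w \<le> u}" using that by simp_all
    moreover have "{w \<in> R ` A. w \<le> u} \<subseteq> {w \<in> R ` A. w \<le> v}" using that(2) by auto
    ultimately show "{w \<in> R ` A. w \<le> u} \<subset> {w \<in> R ` A. w \<le> v}" by blast
  qed (use assms in simp)
  have le: "rank u \<le> rank v \<longleftrightarrow> u \<le> v" if "u \<in> R ` A" "v \<in> R ` A" for u v
    using less[of u v] less[of v u] that by (cases u v rule: linorder_cases) auto
  have pos: "0 < rank v" if "v \<in> R ` A" for v
    unfolding rank_def using that assms by (auto simp: card_gt_0_iff)
  have bound: "rank v \<le> card (R ` A)" for v
    unfolding rank_def by (rule card_mono) (use assms in auto)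
  have inj: "inj_on rank (R ` A)"
  proof (rule inj_onI)
    show "u = v" if "u \<in> R ` A" "v \<in> R ` A" "rank u = rank v" for u v
      using le[of u v] le[of v u] that by simp
  qed
  show thesis
  proof (rule that[of "\<lambda>i\<in>A. rank (R i)"])
    show "(\<lambda>i\<in>A. rank (R i)) \<in> A \<rightarrow>\<^sub>E {1..card (R ` A)}"
      using pos bound by (auto simp: Suc_le_eq)
    show "\<forall>i\<in>A. \<forall>j\<in>A. (\<lambda>i\<in>A. rank (R i)) i \<le> (\<lambda>i\<in>A. rank (R i)) j \<longleftrightarrow> R i \<le> R j"
      using le by simp
    have "(\<lambda>i\<in>A. rank (R i)) ` A = rank ` R ` A" by auto
    then show "card ((\<lambda>i\<in>A. rank (R i)) ` A) = card (R ` A)"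
      using card_image[OF inj] by simp
  qed
qed

text \<open>Keep a witness \<open>i \<in> t\<close> and a witness \<open>j \<in> s\<close> in the lowest class of \<open>Q\<close>. As \<open>Q\<close> takes
  fewer than \<open>n - 1\<close> values, some class has two elements different from \<open>j\<close>; raising the one that
  is not \<open>i\<close> slightly above its class splits that class and preserves the solution.\<close>

lemma refine_solution:
  assumes e: "(t, s) \<in> Eq n" and Q: "Q \<in> V n l {(t, s)}"
    and few: "card (Q ` {1..n}) < l" and "l < n"
  obtains P where "P \<in> V n l {(t, s)}" "Q \<in> point_closure n l P"
    "card (P ` {1..n}) = Suc (card (Q ` {1..n}))"
proof -
  let ?X = "{1..n}"
  have Qp: "Q \<in> points n l" and "is_solution (t, s) Q" using Q by (auto simp: V_def)
  then obtain i j where ij: "i \<in> t" "j \<in> s" "\<forall>k\<in>?X. Q i \<le> Q k \<and> Q j \<le> Q k"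
    using Eq_solution_iff[OF e] by blast
  have inX: "i \<in> ?X" "j \<in> ?X" using e ij by (auto simp: Eq_altdef)
  have "card (Q ` (?X - {j})) \<le> card (Q ` ?X)" by (rule card_mono) auto
  also have "\<dots> < card (?X - {j})" using few \<open>l < n\<close> inX by simp
  finally have "\<not> inj_on Q (?X - {j})" by (rule pigeonhole)
  then obtain a b where ab: "a \<in> ?X" "b \<in> ?X" "a \<noteq> b" "a \<noteq> i" "a \<noteq> j" "Q a = Q b"
    unfolding inj_on_def by (metis DiffE singletonI)
  \<comment> \<open>Doubling frees the odd numbers: \<open>2 * Q a + 1\<close> lies strictly between
    the class of \<open>a\<close> and the next higher one, so \<open>a\<close> leaves its class and
    every strict comparison of \<open>Q\<close> is kept.\<close>
  define R where "R k = 2 * Q k + (if k = a then 1 else 0)" for k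
  have "R ` ?X = insert (2 * Q a + 1) ((\<lambda>v. 2 * v) ` Q ` ?X)"
  proof
    show "R ` ?X \<subseteq> insert (2 * Q a + 1) ((\<lambda>v. 2 * v) ` Q ` ?X)" by (auto simp: R_def)
    \<comment> \<open>The even value that \<open>a\<close> gives up is still attained at
      \<open>b\<close>.\<close>
    have "2 * Q k \<in> R ` ?X" if "k \<in> ?X" for k
      by (rule image_eqI[of _ _ "if k = a then b else k"]) (use that ab in \<open>auto simp: R_def\<close>)
    moreover have "2 * Q a + 1 \<in> R ` ?X"
      by (rule image_eqI[of _ _ a]) (use ab in \<open>auto simp: R_def\<close>)
    ultimately show "insert (2 * Q a + 1) ((\<lambda>v. 2 * v) ` Q ` ?X) \<subseteq> R ` ?X" by auto
  qed
  moreover have "2 * Q a + 1 \<notin> (\<lambda>v. 2 * v) ` Q ` ?X"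
  proof
    assume "2 * Q a + 1 \<in> (\<lambda>v. 2 * v) ` Q ` ?X"
    then obtain v where "2 * Q a + 1 = 2 * v" by blast
    then show False by presburger
  qed
  moreover have "card ((\<lambda>v. 2 * v) ` Q ` ?X) = card (Q ` ?X)"
    by (intro card_image inj_onI) simp
  ultimately have cardR: "card (R ` ?X) = Suc (card (Q ` ?X))" by simp
  obtain P where P: "P \<in> ?X \<rightarrow>\<^sub>E {1..card (R ` ?X)}"
      "\<forall>i\<in>?X. \<forall>j\<in>?X. P i \<le> P j \<longleftrightarrow> R i \<le> R j" "card (P ` ?X) = card (R ` ?X)"
    using order_isomorphic_ranking[of ?X R] by auto
  \<comment> \<open>One value more than \<open>Q\<close> has is still at most \<open>l\<close>, so
    the ranks fit into the chain.\<close>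
  have "{1..card (R ` ?X)} \<subseteq> {1..l}" using cardR few by simp
  then have Pp: "P \<in> points n l" using P(1) unfolding points_def chain_def by (meson PiE_mono subsetD)
  have "\<forall>k\<in>?X. R i \<le> R k \<and> R j \<le> R k" using ij(3) ab by (simp add: R_def trans_le_add1)
  then have "is_solution (t, s) P" using P(2) ij inX Eq_solution_iff[OF e] by blast
  then have "P \<in> V n l {(t, s)}" using Pp by (simp add: V_def)
  moreover have "Q k \<le> Q m" if "R k \<le> R m" for k m
    using that by (auto simp: R_def split: if_splits)
  then have "Q \<in> point_closure n l P" using Qp P(2) by (simp add: point_closure_def)
  ultimately show thesis using that P(3) cardR by simp
qed

section \<open>Surjective solutions and the components of a solution set\<close>

lemma point_closure_mono:
  "Q \<in> point_closure n l P \<Longrightarrow> point_closure n l Q \<subseteq> point_closure n l P"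
  by (rule point_closure_subset_algebraic[OF algebraic_point_closure])

text \<open>Iterates \<open>refine_solution\<close>: the number of missing values decreases each
  time, and the closures grow, so \<open>Q\<close> stays inside.\<close>

lemma refine_to_surjection:
  assumes e: "(t, s) \<in> Eq n" and "l < n" and "Q \<in> V n l {(t, s)}"
  shows "\<exists>P\<in>V n l {(t, s)}. P ` {1..n} = {1..l} \<and> Q \<in> point_closure n l P"
  using assms(3)
proof (induction "l - card (Q ` {1..n})" arbitrary: Q rule: less_induct)
  case less
  have Qp: "Q \<in> points n l" using less.prems by (simp add: V_def)
  then have sub: "Q ` {1..n} \<subseteq> {1..l}" by (auto simp: points_def chain_def)
  show ?case
  proof (cases "card (Q ` {1..n}) < l")
    case True
    obtain R where R: "R \<in> V n l {(t, s)}" "Q \<in> point_closure n l R"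
        "card (R ` {1..n}) = Suc (card (Q ` {1..n}))"
      using refine_solution[OF e less.prems True \<open>l < n\<close>] by blast
    have "l - card (R ` {1..n}) < l - card (Q ` {1..n})" using R(3) True by simp
    then obtain P where "P \<in> V n l {(t, s)}" "P ` {1..n} = {1..l}" "R \<in> point_closure n l P"
      using less.hyps R(1) by blast
    then show ?thesis using R(2) point_closure_mono by blast
  next
    case False
    then have "Q ` {1..n} = {1..l}" using sub by (intro card_subset_eq) (auto dest: card_mono[rotated])
    then show ?thesis using less.prems Qp self_in_point_closure by blast
  qed
qed

text \<open>\<open>P\<close> is a monotone function \<open>f\<close> of \<open>Q\<close>. As
  \<open>P\<close> attains all \<open>l\<close> values, so does \<open>Q\<close>; hence
  \<open>f\<close> is a monotone bijection of \<open>{1..l}\<close>, which must be the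
  identity.\<close>

lemma surjective_point_maximal:
  assumes P: "P ` {1..n} = {1..l}" and Q: "Q \<in> points n l" and PQ: "P \<in> point_closure n l Q"
  shows "P = Q"
proof -
  let ?X = "{1..n}"
  have mono: "P i \<le> P j" if "i \<in> ?X" "j \<in> ?X" "Q i \<le> Q j" for i j
    using that PQ by (simp add: point_closure_def)
  have Psub: "P \<in> points n l" using PQ by (simp add: point_closure_def)
  \<comment> \<open>The choice of preimage is harmless: monotonicity in both directions makes
    \<open>P\<close> constant on each fibre of \<open>Q\<close>.\<close>
  define f where "f v = P (inv_into ?X Q v)" for v
  have fQ: "f (Q i) = P i" if "i \<in> ?X" for i
  proof -
    have "inv_into ?X Q (Q i) \<in> ?X" "Q (inv_into ?X Q (Q i)) = Q i"
      using that by (simp_all add: inv_into_into f_inv_into_f del: atLeastAtMost_iff)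
    then show ?thesis unfolding f_def using mono that by (simp add: order_antisym)
  qed
  have "f ` Q ` ?X = P ` ?X" unfolding image_image by (rule image_cong) (simp_all add: fQ)
  then have im: "f ` Q ` ?X = {1..l}" using P by simp
  have Qsub: "Q ` ?X \<subseteq> {1..l}" using Q by (auto simp: points_def chain_def)
  have "l \<le> card (Q ` ?X)" using im card_image_le[of "Q ` ?X" f] by simp
  then have Qim: "Q ` ?X = {1..l}"
    using Qsub card_mono[OF _ Qsub] by (intro card_subset_eq) auto
  have f_range: "f ` {1..l} = {1..l}" using im unfolding Qim .
  then have inj: "inj_on f {1..l}" by (simp add: eq_card_imp_inj_on)
  have fmono: "f u \<le> f v" if "u \<in> {1..l}" "v \<in> {1..l}" "u \<le> v" for u v
    using that mono fQ unfolding Qim[symmetric] by auto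
  have f_id: "f v = v" if v: "v \<in> {1..l}" for v
  proof -
    have f_le: "f u \<le> f v \<longleftrightarrow> u \<le> v" if "u \<in> {1..l}" for u
    proof
      assume "f u \<le> f v"
      show "u \<le> v"
      proof (rule ccontr)
        assume "\<not> u \<le> v"
        then have "f u = f v" using fmono[OF v that] \<open>f u \<le> f v\<close> by simp
        then have "u = v" using inj that v by (simp only: inj_on_eq_iff)
        then show False using \<open>\<not> u \<le> v\<close> by simp
      qed
    qed (rule fmono[OF that v])
    have "f v \<in> {1..l}" using f_range v by blast
    \<comment> \<open>A strictly increasing bijection carries initial segments to initial segments;
      comparing cardinalities then gives \<open>f v = v\<close>.\<close>
    have "f ` {1..v} = {1..f v}"
    proof
      show "f ` {1..v} \<subseteq> {1..f v}"
      proof (rule image_subsetI)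
        fix u assume "u \<in> {1..v}"
        then have u: "u \<in> {1..l}" "u \<le> v" using v by auto
        then have "f u \<in> {1..l}" using f_range by blast
        then show "f u \<in> {1..f v}" using f_le[OF u(1)] u(2) by simp
      qed
      show "{1..f v} \<subseteq> f ` {1..v}"
      proof
        fix w assume w: "w \<in> {1..f v}"
        then have "w \<in> f ` {1..l}" using \<open>f v \<in> {1..l}\<close> unfolding f_range by simp
        then obtain u where u: "u \<in> {1..l}" "w = f u" by blast
        then have "u \<in> {1..v}" using f_le[OF u(1)] w by simp
        then show "w \<in> f ` {1..v}" using u(2) by blast
      qed
    qed
    then have "card (f ` {1..v}) = f v" by simp
    moreover have "inj_on f {1..v}" by (rule inj_on_subset[OF inj]) (use v in auto)
    ultimately show ?thesis by (simp add: card_image)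
  qed
  have "P i = Q i" if "i \<in> ?X" for i
  proof -
    have "Q i \<in> {1..l}" using Qsub that by blast
    then show ?thesis using f_id fQ[OF that] by simp
  qed
  then show ?thesis using Q Psub unfolding points_def by (intro PiE_ext)
qed

lemma points_surjections: "{P \<in> points n l. P ` {1..n} = {1..l}} = surjections {1..n} {1..l}"
  by (simp add: surjections_def points_def chain_def)

text \<open>The closures of the surjective solutions cover the solution set by
  \<open>refine_to_surjection\<close>. Maximality of surjective points makes these closures pairwise
  incomparable, and also distinct for distinct points, so counting components is counting surjective
  solutions.\<close>

lemma card_irreducible_components:
  assumes e: "(t, s) \<in> Eq n" and "l < n"
  shows "card (irreducible_components n l (V n l {(t, s)})) =
    card {P \<in> surjections {1..n} {1..l}. is_solution (t, s) P}"
proof -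
  define Y where "Y = V n l {(t, s)}"
  define M where "M = {P \<in> surjections {1..n} {1..l}. is_solution (t, s) P}"
  let ?C = "point_closure n l ` M"
  have M: "P \<in> M \<longleftrightarrow> P \<in> Y \<and> P ` {1..n} = {1..l}" for P
    unfolding M_def Y_def points_surjections[symmetric] V_def by (simp add: conj_ac)
  have Mp: "P \<in> points n l" "P ` {1..n} = {1..l}" if "P \<in> M" for P
    using that unfolding M Y_def V_def by simp_all
  have "{(t, s)} \<subseteq> equations n" using e by (simp add: Eq_def)
  then have alg: "algebraic n l Y" unfolding algebraic_def Y_def by (intro exI[of _ "{(t, s)}"] conjI refl)
  have max: "P = Q" if P: "P \<in> M" and Q: "Q \<in> M"
    and sub: "point_closure n l P \<subseteq> point_closure n l Q" for P Q
  proof (rule surjective_point_maximal[OF Mp(2)[OF P] Mp(1)[OF Q]])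
    show "P \<in> point_closure n l Q" using sub self_in_point_closure[OF Mp(1)[OF P]] by (rule subsetD)
  qed
  have "irreducible_decomposition n l Y ?C"
    unfolding irreducible_decomposition_def
  proof (intro conjI ballI impI)
    have "finite M" unfolding M_def by (simp add: finite_surjections)
    then show "finite ?C" by simp
    show "irreducible_algebraic n l Z" if "Z \<in> ?C" for Z
      using that Mp(1) irreducible_point_closure by auto
    show "Y = \<Union>?C"
    proof
      show "Y \<subseteq> \<Union>?C"
      proof
        fix Q assume "Q \<in> Y"
        then obtain P where "P \<in> Y" "P ` {1..n} = {1..l}" "Q \<in> point_closure n l P"
          using refine_to_surjection[OF e \<open>l < n\<close>] unfolding Y_def by metis
        then show "Q \<in> \<Union>?C" by (intro UN_I[of P]) (simp_all add: M)
      qed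
      show "\<Union>?C \<subseteq> Y"
        by (rule UN_least) (rule point_closure_subset_algebraic[OF alg], simp add: M)
    qed
    show "\<not> Z \<subseteq> W" if "Z \<in> ?C" "W \<in> ?C" "Z \<noteq> W" for Z W
      using that max by (elim imageE) metis
  qed
  then have "irreducible_components n l Y = ?C"
    by (rule irreducible_components_eqI)
  moreover have "inj_on (point_closure n l) M"
    by (rule inj_onI) (rule max; simp)
  ultimately show ?thesis unfolding Y_def[symmetric] M_def[symmetric] by (simp only: card_image)
qed

section \<open>Double counting of equations and surjections\<close>

text \<open>The value 1 is attained, so the global minimizers of \<open>P\<close> form the class
  \<open>B\<close> of value 1. By \<open>Eq_solution_iff\<close> the solved equations are the
  covering pairs with both sides meeting \<open>B\<close>.\<close>

lemma card_equations_solved_by: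
  assumes P: "P \<in> surjections {1..n} {1..l}" and "1 \<le> l"
  shows "card {e \<in> Eq n. is_solution e P} + 2 * 3 ^ (n - card {i \<in> {1..n}. P i = 1}) = 3 ^ n"
proof -
  define X where "X = {1..n}"
  define B where "B = {i \<in> X. P i = 1}"
  have X: "finite X" "card X = n" by (simp_all add: X_def)
  have im: "P ` X = {1..l}" using P by (simp add: surjections_def X_def)
  have "1 \<in> P ` X" using \<open>1 \<le> l\<close> unfolding im by simp
  then obtain b where b: "b \<in> X" "P b = 1" by auto
  have B: "B \<subseteq> X" "B \<noteq> {}" using b by (auto simp: B_def)
  have lowest: "(\<forall>k\<in>X. P i \<le> P k) \<longleftrightarrow> i \<in> B" if i: "i \<in> X" for i
  proof -
    have ge: "1 \<le> P k" if "k \<in> X" for k using im that by (metis atLeastAtMost_iff imageI)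
    show ?thesis
    proof
      assume "\<forall>k\<in>X. P i \<le> P k"
      then have "P i \<le> 1" using b by metis
      then show "i \<in> B" using ge[OF i] i by (simp add: B_def)
    qed (use ge in \<open>simp add: B_def\<close>)
  qed
  have "(t, s) \<in> Eq n \<and> is_solution (t, s) P \<longleftrightarrow>
      t \<union> s = X \<and> t \<inter> B \<noteq> {} \<and> s \<inter> B \<noteq> {}" for t s
  proof (cases "(t, s) \<in> Eq n")
    case True
    have sub: "t \<subseteq> X" "s \<subseteq> X" "t \<union> s = X" using True unfolding Eq_altdef X_def by blast+
    have "is_solution (t, s) P \<longleftrightarrow>
        (\<exists>i\<in>t. \<exists>j\<in>s. (\<forall>k\<in>X. P i \<le> P k) \<and> (\<forall>k\<in>X. P j \<le> P k))"
      unfolding Eq_solution_iff[OF True] X_def[symmetric] ball_conj_distrib ..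
    also have "\<dots> \<longleftrightarrow> (\<exists>i\<in>t. \<exists>j\<in>s. i \<in> B \<and> j \<in> B)"
      by (intro bex_cong refl arg_cong2[of _ _ _ _ "(\<and>)"] lowest) (use sub in blast)+
    finally show ?thesis using True sub(3) by blast
  next
    case False
    then show ?thesis unfolding Eq_altdef X_def by blast
  qed
  then have "{e \<in> Eq n. is_solution e P} = {(t, s). t \<union> s = X \<and> t \<inter> B \<noteq> {} \<and> s \<inter> B \<noteq> {}}"
    by (intro set_eqI) (simp only: mem_Collect_eq split_paired_all case_prod_conv)
  then show ?thesis
    using card_covering_pairs_meeting[OF X(1) B]
    unfolding X(2) X_def[symmetric] B_def[symmetric] by (simp only:)
qed

text \<open>Outside its lowest class \<open>B\<close>, such a surjection is an arbitrary surjection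
  onto the remaining \<open>l - 1\<close> values \<open>{2..l}\<close>.\<close>

lemma card_surjections_lowest_class:
  assumes "1 \<le> l" "B \<subseteq> {1..n}" "B \<noteq> {}"
  shows "card {P \<in> surjections {1..n} {1..l}. {i \<in> {1..n}. P i = 1} = B} =
    ordered_Stirling (n - card B) (l - 1)"
proof -
  let ?X = "{1..n}"
  let ?F = "{P \<in> surjections ?X {1..l}. {i \<in> ?X. P i = 1} = B}"
  have split: "{1..l} = insert 1 {2..l}" using assms(1) by auto
  have "bij_betw (\<lambda>P. restrict P (?X - B)) ?F (surjections (?X - B) {2..l})"
  proof (rule bij_betw_byWitness[where f' = "\<lambda>g. \<lambda>i\<in>?X. if i \<in> B then 1 else g i"])
    show "\<forall>P\<in>?F. (\<lambda>i\<in>?X. if i \<in> B then 1 else restrict P (?X - B) i) = P"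
      by (auto simp: surjections_def fun_eq_iff PiE_def extensional_def)
    show "\<forall>g\<in>surjections (?X - B) {2..l}.
        restrict (\<lambda>i\<in>?X. if i \<in> B then 1 else g i) (?X - B) = g"
      by (auto simp: surjections_def fun_eq_iff PiE_def extensional_def)
    show "(\<lambda>P. restrict P (?X - B)) ` ?F \<subseteq> surjections (?X - B) {2..l}"
    proof clarify
      fix P assume P: "P \<in> surjections ?X {1..l}" and B: "B = {i \<in> ?X. P i = 1}"
      have "P ` (?X - B) = P ` ?X - {1}" using B by auto
      also have "\<dots> = {2..l}" using P by (auto simp: surjections_def)
      finally have "P ` (?X - B) = {2..l}" .
      then show "restrict P (?X - {i \<in> ?X. P i = 1}) \<in> surjections (?X - {i \<in> ?X. P i = 1}) {2..l}"
        unfolding B[symmetric] surjections_def by (auto simp: PiE_def)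
    qed
    show "(\<lambda>g. \<lambda>i\<in>?X. if i \<in> B then 1 else g i) ` surjections (?X - B) {2..l} \<subseteq> ?F"
    proof clarify
      fix g assume g: "g \<in> surjections (?X - B) {2..l}"
      let ?P = "\<lambda>i\<in>?X. if i \<in> B then 1 else g i"
      have gim: "g ` (?X - B) = {2..l}" using g by (simp add: surjections_def)
      have "?P ` ?X = ?P ` B \<union> ?P ` (?X - B)"
        unfolding image_Un[symmetric] using assms(2) by (simp only: Un_Diff_cancel Un_absorb1)
      also have "?P ` B = (\<lambda>_. 1) ` B" by (rule image_cong) (use assms(2) in auto)
      also have "\<dots> = {1}" using assms(3) by (simp only: image_constant_conv if_False)
      also have "?P ` (?X - B) = g ` (?X - B)" by (rule image_cong) auto
      finally have im: "?P ` ?X = {1..l}" using gim split by simp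
      have "?P \<in> surjections ?X {1..l}"
        unfolding surjections_altdef mem_Collect_eq by (intro conjI restrict_extensional im)
      moreover have "i \<in> {i \<in> ?X. ?P i = 1} \<longleftrightarrow> i \<in> B" for i
      proof (cases "i \<in> ?X - B")
        case True
        then have "g i \<in> {2..l}" unfolding gim[symmetric] by blast
        then show ?thesis using True by simp
      qed (use assms(2) in auto)
      ultimately show "?P \<in> surjections ?X {1..l} \<and> {i \<in> ?X. ?P i = 1} = B"
        by (intro conjI set_eqI)
    qed
  qed
  from bij_betw_same_card[OF this] show ?thesis
    using assms(2) by (simp add: card_surjections card_Diff_subset finite_subset)
qed

text \<open>Surjections are grouped by their lowest class, and the classes are then grouped by size,
  which yields the binomial coefficient.\<close>

lemma sum_lowest_class_powers:
  assumes "2 \<le> l"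
  shows "(\<Sum>P\<in>surjections {1..n} {1..l}. 3 ^ (n - card {i \<in> {1..n}. P i = 1})) = S_sum n l"
proof -
  define X where "X = {1..n}"
  define low where "low P = {i \<in> X. P i = 1}" for P :: "nat \<Rightarrow> nat"
  define M where "M = surjections X {1..l}"
  define classes where "classes = {B. B \<subseteq> X \<and> card B \<in> {1..n - 1}}"
  have X: "finite X" "card X = n" by (simp_all add: X_def)
  have finM: "finite M" unfolding M_def using X(1) by (simp add: finite_surjections)
  have fin_classes: "finite classes" unfolding classes_def using X(1) by simp
  have low: "low P \<in> classes" if "P \<in> M" for P
  proof -
    have im: "P ` X = {1..l}" using that by (simp add: surjections_def M_def)
    \<comment> \<open>The value 1 makes the lowest class non-empty, and the value 2, available since
      \<open>l\<close> is at least 2, keeps it proper. This is why the sizes run exactly from 1 to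
      \<open>n - 1\<close>.\<close>
    have "1 \<in> P ` X" "2 \<in> P ` X" using assms unfolding im by auto
    then obtain i j where "i \<in> X" "P i = 1" "j \<in> X" "P j = 2" by (metis imageE)
    then have "i \<in> low P" "j \<in> X" "j \<notin> low P" by (simp_all add: low_def)
    moreover have "low P \<subseteq> X" by (auto simp: low_def)
    ultimately have "low P \<noteq> {}" "low P \<subset> X" by blast+
    then have "1 \<le> card (low P)" "card (low P) < n"
      using psubset_card_mono[OF X(1)] X finite_subset[of "low P" X]
      by (auto simp: Suc_le_eq card_gt_0_iff)
    then show ?thesis using \<open>low P \<subseteq> X\<close> by (simp add: classes_def)
  qed
  have "(\<Sum>P\<in>M. 3 ^ (n - card (low P))) =
      (\<Sum>B\<in>classes. \<Sum>P\<in>{P \<in> M. low P = B}. 3 ^ (n - card (low P)))"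
    by (rule sum.group[symmetric, OF finM fin_classes]) (use low in blast)
  also have "\<dots> = (\<Sum>B\<in>classes. ordered_Stirling (n - card B) (l - 1) * 3 ^ (n - card B))"
  proof (rule sum.cong[OF refl])
    fix B assume "B \<in> classes"
    then have "B \<subseteq> {1..n}" "B \<noteq> {}" by (auto simp: classes_def X_def)
    then have "card {P \<in> M. low P = B} = ordered_Stirling (n - card B) (l - 1)"
      using card_surjections_lowest_class[of l B n] assms unfolding M_def low_def X_def by linarith
    moreover have "(\<Sum>P\<in>{P \<in> M. low P = B}. 3 ^ (n - card (low P))) =
        (\<Sum>P\<in>{P \<in> M. low P = B}. 3 ^ (n - card B) :: nat)"
      by (rule sum.cong) auto
    ultimately show "(\<Sum>P\<in>{P \<in> M. low P = B}. 3 ^ (n - card (low P))) =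
        ordered_Stirling (n - card B) (l - 1) * 3 ^ (n - card B)"
      by simp
  qed
  also have "\<dots> = (\<Sum>i\<in>{1..n - 1}. \<Sum>B\<in>{B \<in> classes. card B = i}.
      ordered_Stirling (n - card B) (l - 1) * 3 ^ (n - card B))"
    by (rule sum.group[symmetric, OF fin_classes]) (auto simp: classes_def)
  also have "\<dots> = S_sum n l"
    unfolding S_sum_def
  proof (rule sum.cong[OF refl])
    fix i assume "i \<in> {1..n - 1}"
    then have "{B \<in> classes. card B = i} = {B. B \<subseteq> X \<and> card B = i}" by (auto simp: classes_def)
    then have "card {B \<in> classes. card B = i} = n choose i" using n_subsets[OF X(1)] X(2) by simp
    moreover have "(\<Sum>B\<in>{B \<in> classes. card B = i}.
          ordered_Stirling (n - card B) (l - 1) * 3 ^ (n - card B)) =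
        (\<Sum>B\<in>{B \<in> classes. card B = i}. ordered_Stirling (n - i) (l - 1) * 3 ^ (n - i))"
      by (rule sum.cong) auto
    ultimately show "(\<Sum>B\<in>{B \<in> classes. card B = i}.
          ordered_Stirling (n - card B) (l - 1) * 3 ^ (n - card B)) =
        (n choose i) * ordered_Stirling (n - i) (l - 1) * 3 ^ (n - i)"
      by simp
  qed
  finally show ?thesis unfolding M_def low_def X_def .
qed

theorem mainTheorem4:
  fixes n l :: nat
  assumes "2 \<le> l" and "l < n"
  shows "Irr_avg n l = (3 ^ n * real (ordered_Stirling n l) - 2 * real (S_sum n l)) / (3 ^ n - 2)"
proof -
  let ?M = "surjections {1..n} {1..l}"
  let ?comp = "\<lambda>e. card (irreducible_components n l (V n l {e}))"
  have finM: "finite ?M" by (simp add: finite_surjections)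
  have "(\<Sum>e\<in>Eq n. ?comp e) = (\<Sum>e\<in>Eq n. card {P \<in> ?M. is_solution e P})"
    using card_irreducible_components \<open>l < n\<close> by (intro sum.cong) auto
  \<comment> \<open>Pairs of an equation and a surjection solving it are counted from the other
    side.\<close>
  also have "\<dots> = (\<Sum>P\<in>?M. card {e \<in> Eq n. is_solution e P})"
    unfolding card_eq_sum by (rule sum.swap_restrict[OF finite_Eq finM])
  finally have comp: "(\<Sum>e\<in>Eq n. ?comp e) = (\<Sum>P\<in>?M. card {e \<in> Eq n. is_solution e P})" .
  \<comment> \<open>The term to be subtracted is kept on the left while counting in
    \<open>nat\<close>; it is moved across only after passing to the reals.\<close>
  have "(\<Sum>e\<in>Eq n. ?comp e) + 2 * S_sum n l =
      (\<Sum>P\<in>?M. card {e \<in> Eq n. is_solution e P} + 2 * 3 ^ (n - card {i \<in> {1..n}. P i = 1}))"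
    unfolding comp sum_lowest_class_powers[OF assms(1), of n, symmetric]
    by (simp only: sum.distrib sum_distrib_left)
  also have "\<dots> = (\<Sum>P\<in>?M. 3 ^ n)"
    by (intro sum.cong card_equations_solved_by) (use assms in auto)
  also have "\<dots> = 3 ^ n * ordered_Stirling n l"
    by (simp only: sum_constant card_surjections finite_atLeastAtMost card_atLeastAtMost
        diff_Suc_1 of_nat_id mult.commute)
  finally have "(\<Sum>e\<in>Eq n. ?comp e) + 2 * S_sum n l = 3 ^ n * ordered_Stirling n l" .
  then have "real (\<Sum>e\<in>Eq n. ?comp e) + 2 * real (S_sum n l) = 3 ^ n * real (ordered_Stirling n l)"
    unfolding of_nat_eq_iff[where 'a = real, symmetric]
    by (simp only: of_nat_add of_nat_mult of_nat_power of_nat_numeral)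
  then have num: "(\<Sum>e\<in>Eq n. real (?comp e)) =
      3 ^ n * real (ordered_Stirling n l) - 2 * real (S_sum n l)"
    unfolding of_nat_sum by linarith
  have "card (Eq n) + 2 = 3 ^ n" using assms by (intro card_Eq) linarith
  then have "real (card (Eq n)) + 2 = 3 ^ n"
    unfolding of_nat_eq_iff[where 'a = real, symmetric]
    by (simp only: of_nat_add of_nat_power of_nat_numeral)
  then have "real (card (Eq n)) = 3 ^ n - 2" by linarith
  then show ?thesis unfolding Irr_avg_def num by (simp only:)
qed

end
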